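(* Let $\langle L,\leq,{}^\bot,\wedge\rangle$ be an orthomodular lattice (with join $\vee$), and define the binary operation $\&_\wedge : L^2\to L$ by $$ a \,\&_\wedge\, b = b \wedge (b^\bot \vee a). $$ Then $\langle L,\leq,{}^\bot,\&_\wedge\rangle$ is a Sasaki orthoposet.
   Context: A bounded orthoposet $\langle P,\leq,{}^\bot\rangle$ is a partially ordered set with least element $0$ and greatest element $1$ and an orthocomplementation $a\mapsto a^\bot$, i.e. an order-reversing involution ($a\le b\Rightarrow b^\bot\le a^\bot$, $a^{\bot\bot}=a$) such that for every $a$ the meet of $a$ and $a^\bot$ exists and is $0$, and their join exists and is $1$. An ortholattice is a bounded orthoposet that is a lattice. An orthomodular lattice is an ortholattice in which $a\leq b$ implies $a=b\wedge(a\vee b^\bot)$. A Sasaki orthoposet is a tuple $\langle P,\leq,{}^\bot,\&\rangle$ where $\langle P,\leq,{}^\bot\rangle$ is a bounded orthoposet and $\&:P^2\to P$ is a total binary operation such that for all $a,b,c\in P$: (L-Monotony) $a\le b \Rightarrow a\,\&\,c\le b\,\&\,c$; (R-Reduction) $a\,\&\,b\le b$; (Orthomodularity) $a\le b\Rightarrow a=a\,\&\,b$; (Galois) $a\,\&\,b\le c\Rightarrow c^\bot\,\&\,b\le a^\bot$. *)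

theory Defs
  imports "HOL-Library.Complemented_Lattices"
begin

text \<open>
  Meets and joins in an orthoposet exist only for some pairs, so they are relations here rather
  than the operations \<^const>\<open>inf\<close> and \<^const>\<open>sup\<close> of a lattice.
\<close>

definition is_meet :: "'a::order \<Rightarrow> 'a \<Rightarrow> 'a \<Rightarrow> bool" where
  "is_meet a b m \<longleftrightarrow> m \<le> a \<and> m \<le> b \<and> (\<forall>x. x \<le> a \<longrightarrow> x \<le> b \<longrightarrow> x \<le> m)"

definition is_join :: "'a::order \<Rightarrow> 'a \<Rightarrow> 'a \<Rightarrow> bool" where
  "is_join a b j \<longleftrightarrow> a \<le> j \<and> b \<le> j \<and> (\<forall>x. a \<le> x \<longrightarrow> b \<le> x \<longrightarrow> j \<le> x)"

locale bounded_orthoposet =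
  fixes ocompl :: "'a::{order_bot,order_top} \<Rightarrow> 'a"
  assumes ocompl_antimono: "a \<le> b \<Longrightarrow> ocompl b \<le> ocompl a"
    and ocompl_involution: "ocompl (ocompl a) = a"
    and meet_ocompl: "is_meet a (ocompl a) bot"
    and join_ocompl: "is_join a (ocompl a) top"

locale sasaki_orthoposet = bounded_orthoposet ocompl
  for ocompl :: "'a::{order_bot,order_top} \<Rightarrow> 'a" +
  fixes sand :: "'a \<Rightarrow> 'a \<Rightarrow> 'a"  (infixl "\<and>\<^sub>S" 70)
  assumes L_monotony: "a \<le> b \<Longrightarrow> a \<and>\<^sub>S c \<le> b \<and>\<^sub>S c"
    and R_reduction: "a \<and>\<^sub>S b \<le> b"
    and orthomodularity: "a \<le> b \<Longrightarrow> a = a \<and>\<^sub>S b"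
    and galois: "a \<and>\<^sub>S b \<le> c \<Longrightarrow> ocompl c \<and>\<^sub>S b \<le> ocompl a"

definition sasaki_conj :: "'a::orthocomplemented_lattice \<Rightarrow> 'a \<Rightarrow> 'a" where
  "sasaki_conj a b = inf b (sup (- b) a)"

text \<open>
  The class \<^class>\<open>orthomodular_lattice\<close> states the orthomodular law in the join form (left-hand
  side below). The meet form \<open>a \<le> b \<Longrightarrow> a = b \<and> (a \<or> b\<^sup>\<bottom>)\<close> is equivalent to it by duality.
\<close>

lemma orthomodular_law_meet_form:
  "(\<forall>x y :: 'a::orthocomplemented_lattice. x \<le> y \<longrightarrow> sup x (inf (- x) y) = y) \<longleftrightarrow>
   (\<forall>a b :: 'a. a \<le> b \<longrightarrow> a = inf b (sup a (- b)))"
  (is "?J \<longleftrightarrow> ?M")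
proof
  assume J: ?J
  show ?M
  proof (intro allI impI)
    fix a b :: 'a
    assume "a \<le> b"
    then have "sup (- b) (inf (- (- b)) (- a)) = - a"
      using J by (metis compl_le_compl_iff)
    then have "- sup (- b) (inf (- (- b)) (- a)) = a" by simp
    then show "a = inf b (sup a (- b))" by (simp add: sup_commute)
  qed
next
  assume M: ?M
  show ?J
  proof (intro allI impI)
    fix x y :: 'a
    assume "x \<le> y"
    then have "- y = inf (- x) (sup (- y) (- (- x)))"
      using M by (metis compl_le_compl_iff)
    then have "- (- y) = - inf (- x) (sup (- y) (- (- x)))" by (rule arg_cong)
    then show "sup x (inf (- x) y) = y" by (simp add: inf_commute)
  qed
qed

end

theory Submission
  imports Defs
begin

text \<open>This is the orthomodular law in meet form with the join commuted; the class axiom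
  \<open>orthomodular\<close> supplies the join form.\<close>

lemma sasaki_conj_of_le:
  fixes a b :: "'a::orthomodular_lattice"
  assumes "a \<le> b"
  shows "sasaki_conj a b = a"
  using orthomodular_law_meet_form[where 'a='a] orthomodular assms
  by (metis sasaki_conj_def sup_commute)

lemma sasaki_conj_mono:
  "a \<le> b \<Longrightarrow> sasaki_conj a c \<le> sasaki_conj b c"
  unfolding sasaki_conj_def by (intro inf_mono sup_mono order_refl)

text \<open>
  By De Morgan the hypothesis says \<open>c\<^sup>\<bottom> \<le> b\<^sup>\<bottom> \<or> d\<close> with \<open>d = b \<and> a\<^sup>\<bottom>\<close>; since \<open>d \<le> b\<close>,
  orthomodularity collapses \<open>b \<and> (b\<^sup>\<bottom> \<or> d)\<close> to \<open>d \<le> a\<^sup>\<bottom>\<close>.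
\<close>

lemma sasaki_conj_galois:
  fixes a b c :: "'a::orthomodular_lattice"
  assumes "sasaki_conj a b \<le> c"
  shows "sasaki_conj (- c) b \<le> - a"
proof -
  have "- c \<le> - sasaki_conj a b"
    using assms by simp
  then have "- c \<le> sup (- b) (inf b (- a))"
    by (simp add: sasaki_conj_def)
  \<comment> \<open>The right-hand side already lies above \<open>- b\<close>, so it also bounds
    \<open>sup (- b) (- c)\<close>; then meet both sides with \<open>b\<close>.\<close>
  then have "sasaki_conj (- c) b \<le> sasaki_conj (inf b (- a)) b"
    by (auto simp: sasaki_conj_def intro: le_infI2)
  also have "\<dots> = inf b (- a)"
    by (simp add: sasaki_conj_of_le)
  finally show ?thesis by simp
qed

theorem proposition4:
  shows "sasaki_orthoposet (uminus :: 'a::orthomodular_lattice \<Rightarrow> 'a) sasaki_conj"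
proof
  fix a b c :: 'a
  show "a \<le> b \<Longrightarrow> - b \<le> - a" by simp
  show "- (- a) = a" by simp
  \<comment> \<open>A common lower bound of \<open>a\<close> and \<open>- a\<close> lies below
    \<open>inf a (- a) = bot\<close>; the join is dual.\<close>
  show "is_meet a (- a) bot"
    unfolding is_meet_def by (metis inf_compl_bot inf_greatest bot_least)
  show "is_join a (- a) top"
    unfolding is_join_def by (metis sup_compl_top sup_least top_greatest)
  show "a \<le> b \<Longrightarrow> sasaki_conj a c \<le> sasaki_conj b c" by (rule sasaki_conj_mono)
  show "sasaki_conj a b \<le> b" by (simp add: sasaki_conj_def)
  show "a \<le> b \<Longrightarrow> a = sasaki_conj a b" by (simp add: sasaki_conj_of_le)
  show "sasaki_conj a b \<le> c \<Longrightarrow> sasaki_conj (- c) b \<le> - a" by (rule sasaki_conj_galois)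
qed

end
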